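(* Let $\Phi$ be a Young function with $\Phi\in\Delta_2$. Let $(\xi_n)_n$ be a norm bounded sequence in $L_{\Phi^*}$ which converges in probability to some $\xi\in L_{\Phi^*}$. Then there exists a subsequence $(\xi_{n_k})_k$ such that for any further subsequence $(\xi_{n_{k(i)}})_i$, the Cesàro means $\frac1N\sum_{i\le N}\xi_{n_{k(i)}}$ converge in order to $\xi$, i.e. $$\sup_N\Bigl|\frac1N\sum_{i\le N}\xi_{n_{k(i)}}\Bigr|\in L_{\Phi^*}\quad\text{and}\quad \frac1N\sum_{i\le N}\xi_{n_{k(i)}}\to\xi \text{ a.s. as } N\to\infty.$$
   Context: $(\Omega,\mathcal F,\mathbb P)$ is a probability space, $L_0$ is the space of $\mathbb P$-a.s. equivalence classes of finite real measurable functions, $\mathbb E$ is expectation. A (finite coercive) Young function is an even convex function $\Phi:\mathbb R\to\mathbb R$ with $\Phi(0)=0$ and $\lim_{x\to+\infty}\Phi(x)/x=+\infty$; its conjugate $\Phi^*(y)=\sup_x(xy-\Phi(x))$ is again such a function. $\Phi\in\Delta_2$ means $\limsup_{x\to\infty}\Phi(2x)/\Phi(x)<\infty$. For a Young function $\Psi$, $\mathbb B_\Psi=\{\xi\in L_0:\mathbb E[\Psi(\xi)]\le 1\}$, and the Orlicz space is $L_\Psi=\bigcup_{\lambda>0}\lambda\mathbb B_\Psi$ with norm $\|\xi\|_\Psi=\inf\{\lambda>0:\xi\in\lambda\mathbb B_\Psi\}$ and the a.s. pointwise order. *)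

theory Defs
  imports "HOL-Probability.Probability"
begin

definition young_function :: "(real \<Rightarrow> real) \<Rightarrow> bool" where
  "young_function \<Phi> \<longleftrightarrow>
     (\<forall>x. \<Phi> (- x) = \<Phi> x) \<and> convex_on UNIV \<Phi> \<and> \<Phi> 0 = 0 \<and>
     filterlim (\<lambda>x. \<Phi> x / x) at_top at_top"

text \<open>
  The supremum below is taken in the reals. For a Young function the set
  \<open>{x * y - \<Phi> x | x. True}\<close> is bounded above because \<open>\<Phi>\<close> is superlinear and even,
  so this is the usual supremum.
\<close>

definition young_conjugate :: "(real \<Rightarrow> real) \<Rightarrow> real \<Rightarrow> real" where
  "young_conjugate \<Phi> y = (SUP x. x * y - \<Phi> x)"

definition Delta2 :: "(real \<Rightarrow> real) \<Rightarrow> bool" where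
  "Delta2 \<Phi> \<longleftrightarrow> Limsup at_top (\<lambda>x. ereal (\<Phi> (2 * x) / \<Phi> x)) < \<infinity>"

text \<open>
  Elements of \<open>L\<^sub>0\<close> are represented by real-valued Borel measurable functions. The sets and
  the norm below are invariant under almost sure equality. Young functions are nonnegative, so
  the expectation of \<open>\<Psi>(\<xi>)\<close>, with values in \<open>[0, \<infinity>]\<close>, is the nonnegative Lebesgue integral.
\<close>

definition orlicz_ball :: "'a measure \<Rightarrow> (real \<Rightarrow> real) \<Rightarrow> ('a \<Rightarrow> real) set" where
  "orlicz_ball M \<Psi> = {\<xi> \<in> borel_measurable M. (\<integral>\<^sup>+\<omega>. ennreal (\<Psi> (\<xi> \<omega>)) \<partial>M) \<le> 1}"

definition scaled_orlicz_ball :: "real \<Rightarrow> 'a measure \<Rightarrow> (real \<Rightarrow> real) \<Rightarrow> ('a \<Rightarrow> real) set" where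
  "scaled_orlicz_ball c M \<Psi> = (\<lambda>\<xi> \<omega>. c * \<xi> \<omega>) ` orlicz_ball M \<Psi>"

definition orlicz_space :: "'a measure \<Rightarrow> (real \<Rightarrow> real) \<Rightarrow> ('a \<Rightarrow> real) set" where
  "orlicz_space M \<Psi> = (\<Union>c\<in>{0<..}. scaled_orlicz_ball c M \<Psi>)"

definition orlicz_norm :: "'a measure \<Rightarrow> (real \<Rightarrow> real) \<Rightarrow> ('a \<Rightarrow> real) \<Rightarrow> real" where
  "orlicz_norm M \<Psi> \<xi> = Inf {c. c > 0 \<and> \<xi> \<in> scaled_orlicz_ball c M \<Psi>}"

text \<open>
  A supremum of countably many elements of \<open>L\<^sub>0\<close> is a priori only an extended real function.
  It belongs to the Orlicz space iff it is almost surely equal to a (finite) element of it.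
\<close>

definition ereal_mem_orlicz :: "'a measure \<Rightarrow> (real \<Rightarrow> real) \<Rightarrow> ('a \<Rightarrow> ereal) \<Rightarrow> bool" where
  "ereal_mem_orlicz M \<Psi> f \<longleftrightarrow> (\<exists>\<eta>\<in>orlicz_space M \<Psi>. AE \<omega> in M. f \<omega> = ereal (\<eta> \<omega>))"

definition tendsto_in_prob ::
  "'a measure \<Rightarrow> (nat \<Rightarrow> 'a \<Rightarrow> real) \<Rightarrow> ('a \<Rightarrow> real) \<Rightarrow> bool" where
  "tendsto_in_prob M X Y \<longleftrightarrow>
     (\<forall>\<epsilon>>0. (\<lambda>n. measure M {\<omega> \<in> space M. \<bar>X n \<omega> - Y \<omega>\<bar> > \<epsilon>}) \<longlonglongrightarrow> 0)"

text \<open>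
  The mean of the first \<open>N\<close> terms of \<open>X\<close>, where sequences are indexed from \<open>0\<close>.
\<close>

definition cesaro_mean :: "(nat \<Rightarrow> 'a \<Rightarrow> real) \<Rightarrow> nat \<Rightarrow> 'a \<Rightarrow> real" where
  "cesaro_mean X N \<omega> = (1 / real N) * (\<Sum>i<N. X i \<omega>)"

end

theory Submission
  imports Defs
begin

text \<open>
  Write \<open>\<Psi>\<close> for the conjugate of \<open>\<Phi>\<close>. Along an a.s. convergent subsequence the Cesaro means
  converge a.s., so only the maximal function of the means has to be controlled. Put
  \<open>z\<^sub>n = \<bar>X\<^sub>n - \<xi>\<bar> / (2 c)\<close> with \<open>c\<close> so large that \<open>E \<Psi>(z\<^sub>n) \<le> 1\<close>. The sets \<open>{z\<^sub>n > 1}\<close> shrink, and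
  a sparse subsequence makes the \<open>\<Psi>\<close>-mass of all earlier terms on them summable. If \<open>m < N\<close> is
  the last index with \<open>z\<^sub>m > 1\<close>, then the mean of the first \<open>N\<close> terms is at most
  \<open>b + z\<^sub>m / (m + 1)\<close>, where \<open>b\<close> is the maximum of 1 and the terms before \<open>m\<close>, and \<open>\<Psi>(b)\<close> is
  controlled by that sum.
  For the other summand, \<open>\<Phi> \<in> \<Delta>\<^sub>2\<close> gives \<open>2 a \<Psi>(y) \<le> \<Psi>(a y)\<close> for large \<open>y\<close> and some \<open>a > 1\<close>, hence
  \<open>\<Psi>(x / n) \<le> C n\<^sup>-\<^sup>p \<Psi>(x)\<close> with \<open>p > 1\<close> as long as \<open>x / n\<close> is large, which is summable in \<open>n\<close>.
\<close>

section \<open>Even convex functions and the Orlicz balls that they define\<close>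

text \<open>The common core of \<open>\<Phi>\<close> and its conjugate: the locale is interpreted
  for both, so elementary facts such as nonnegativity are proved once.\<close>

locale even_convex =
  fixes \<Psi> :: "real \<Rightarrow> real"
  assumes even: "\<Psi> (- x) = \<Psi> x"
    and convex: "convex_on UNIV \<Psi>"
    and zero: "\<Psi> 0 = 0"
begin

lemma abs_arg [simp]: "\<Psi> \<bar>x\<bar> = \<Psi> x"
  using even by (simp add: abs_if)

lemma midpoint: "\<Psi> ((x + y) / 2) \<le> (\<Psi> x + \<Psi> y) / 2"
  using convex_onD[OF convex, of "1/2" x y] by (simp add: field_simps)

lemma nonneg [simp]: "0 \<le> \<Psi> x"
  using midpoint[of x "- x"] by (simp add: even zero)

lemma scale: "0 \<le> t \<Longrightarrow> t \<le> 1 \<Longrightarrow> \<Psi> (t * x) \<le> t * \<Psi> x"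
  using convex_onD[OF convex, of t 0 x] by (simp add: zero)

text \<open>The value at \<open>\<bar>x\<bar>\<close> lies below the chord from the origin to the
  graph over \<open>\<bar>y\<bar>\<close>, whose slope is nonnegative.\<close>

lemma mono:
  assumes "\<bar>x\<bar> \<le> \<bar>y\<bar>"
  shows "\<Psi> x \<le> \<Psi> y"
proof (cases "y = 0")
  case False
  have "\<Psi> (\<bar>x\<bar> / \<bar>y\<bar> * \<bar>y\<bar>) \<le> \<bar>x\<bar> / \<bar>y\<bar> * \<Psi> \<bar>y\<bar>"
    using assms False by (intro scale) auto
  also have "\<dots> \<le> 1 * \<Psi> y"
    using assms False by (intro mult_mono) auto
  finally show ?thesis using False by simp
qed (use assms in simp)

lemma measurable [measurable]: "\<Psi> \<in> borel_measurable borel"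
  by (intro borel_measurable_continuous_onI convex_on_continuous convex open_UNIV)

lemma scaled_ball_iff:
  assumes "c > 0"
  shows "f \<in> scaled_orlicz_ball c M \<Psi> \<longleftrightarrow>
    f \<in> borel_measurable M \<and> (\<integral>\<^sup>+\<omega>. ennreal (\<Psi> (f \<omega> / c)) \<partial>M) \<le> 1"
proof
  assume "f \<in> scaled_orlicz_ball c M \<Psi>"
  then show "f \<in> borel_measurable M \<and> (\<integral>\<^sup>+\<omega>. ennreal (\<Psi> (f \<omega> / c)) \<partial>M) \<le> 1"
    using assms by (auto simp: scaled_orlicz_ball_def orlicz_ball_def)
next
  assume "f \<in> borel_measurable M \<and> (\<integral>\<^sup>+\<omega>. ennreal (\<Psi> (f \<omega> / c)) \<partial>M) \<le> 1"
  then show "f \<in> scaled_orlicz_ball c M \<Psi>"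
    using assms unfolding scaled_orlicz_ball_def orlicz_ball_def
    by (intro image_eqI[of _ _ "\<lambda>\<omega>. f \<omega> / c"]) auto
qed

lemma scaled_ball_mono:
  assumes "0 < c" "c \<le> d" "f \<in> scaled_orlicz_ball c M \<Psi>"
  shows "f \<in> scaled_orlicz_ball d M \<Psi>"
proof -
  have "(\<integral>\<^sup>+\<omega>. ennreal (\<Psi> (f \<omega> / d)) \<partial>M) \<le> (\<integral>\<^sup>+\<omega>. ennreal (\<Psi> (f \<omega> / c)) \<partial>M)"
    using assms(1,2) by (intro nn_integral_mono ennreal_leI mono)
      (auto simp: frac_le)
  then show ?thesis using assms by (auto simp: scaled_ball_iff intro: order_trans)
qed

text \<open>The strict inequality makes it irrelevant whether the infimum is attained: some
  admissible \<open>c < d\<close> exists, and the balls grow with the radius. Membership in the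
  space keeps \<open>Inf\<close> away from the empty set.\<close>

lemma orlicz_norm_less_imp_scaled_ball:
  assumes "f \<in> orlicz_space M \<Psi>" "orlicz_norm M \<Psi> f < d"
  shows "d > 0" "f \<in> scaled_orlicz_ball d M \<Psi>"
proof -
  have "{c. c > 0 \<and> f \<in> scaled_orlicz_ball c M \<Psi>} \<noteq> {}"
    using assms(1) by (auto simp: orlicz_space_def)
  from cInf_lessD[OF this] assms(2) obtain c
    where "c > 0" "f \<in> scaled_orlicz_ball c M \<Psi>" "c < d"
    unfolding orlicz_norm_def by blast
  then show "d > 0" "f \<in> scaled_orlicz_ball d M \<Psi>"
    using scaled_ball_mono[of c d f M] by auto
qed

text \<open>\<open>(f - g) / (2 * c)\<close> is the midpoint of \<open>f / c\<close> and
  \<open>- g / c\<close>, so convexity and evenness bound its modular by the mean of the two given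
  ones.\<close>

lemma scaled_ball_diff:
  assumes "c > 0" "f \<in> scaled_orlicz_ball c M \<Psi>" "g \<in> scaled_orlicz_ball c M \<Psi>"
  shows "(\<lambda>\<omega>. f \<omega> - g \<omega>) \<in> scaled_orlicz_ball (2 * c) M \<Psi>"
proof -
  have [measurable]: "f \<in> borel_measurable M" "g \<in> borel_measurable M"
    and le: "(\<integral>\<^sup>+\<omega>. ennreal (\<Psi> (f \<omega> / c)) \<partial>M) \<le> 1" "(\<integral>\<^sup>+\<omega>. ennreal (\<Psi> (g \<omega> / c)) \<partial>M) \<le> 1"
    using assms by (auto simp: scaled_ball_iff)
  have "ennreal (\<Psi> ((f \<omega> - g \<omega>) / (2 * c)))
      \<le> ennreal (1/2) * (ennreal (\<Psi> (f \<omega> / c)) + ennreal (\<Psi> (g \<omega> / c)))" for \<omega>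
  proof -
    have eq: "(f \<omega> - g \<omega>) / (2 * c) = (f \<omega> / c + - (g \<omega> / c)) / 2"
      by (simp add: diff_divide_distrib)
    have "\<Psi> ((f \<omega> - g \<omega>) / (2 * c)) \<le> 1/2 * (\<Psi> (f \<omega> / c) + \<Psi> (g \<omega> / c))"
      unfolding eq using midpoint[of "f \<omega> / c" "- (g \<omega> / c)"] 
      unfolding even by simp
    then show ?thesis
      by (metis ennreal_leI ennreal_mult' ennreal_plus nonneg half_bounded_equal zero_le_divide_1_iff zero_le_numeral)
  qed
  then have "(\<integral>\<^sup>+\<omega>. ennreal (\<Psi> ((f \<omega> - g \<omega>) / (2 * c))) \<partial>M)
      \<le> (\<integral>\<^sup>+\<omega>. ennreal (1/2) * (ennreal (\<Psi> (f \<omega> / c)) + ennreal (\<Psi> (g \<omega> / c))) \<partial>M)"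
    by (intro nn_integral_mono)
  also have "\<dots> = ennreal (1/2) * ((\<integral>\<^sup>+\<omega>. ennreal (\<Psi> (f \<omega> / c)) \<partial>M) + (\<integral>\<^sup>+\<omega>. ennreal (\<Psi> (g \<omega> / c)) \<partial>M))"
    by (simp add: nn_integral_cmult nn_integral_add)
  also have "\<dots> \<le> ennreal (1/2) * (1 + 1)"
    by (intro mult_left_mono add_mono le) simp
  also have "\<dots> = ennreal (1/2 * 2)"
    by (subst ennreal_mult) auto
  finally show ?thesis using assms(1) by (simp add: scaled_ball_iff)
qed

text \<open>Dividing the argument by a further \<open>R \<ge> 1\<close> divides the modular by at
  least \<open>R\<close>; an \<open>R\<close> above the finite modular brings it down to 1.\<close>

lemma orlicz_space_if_finite_modular:
  assumes "f \<in> borel_measurable M" "c > 0"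
    and "(\<integral>\<^sup>+\<omega>. ennreal (\<Psi> (f \<omega> / c)) \<partial>M) < \<infinity>"
  shows "f \<in> orlicz_space M \<Psi>"
proof -
  have [measurable]: "f \<in> borel_measurable M" by fact
  from assms(3) obtain b where b: "b \<ge> 0" "(\<integral>\<^sup>+\<omega>. ennreal (\<Psi> (f \<omega> / c)) \<partial>M) = ennreal b"
    by (metis ennreal_cases infinity_ennreal_def less_irrefl)
  define R where "R = max 1 b"
  have R: "R \<ge> 1" "b \<le> R" by (auto simp: R_def)
  have "(\<integral>\<^sup>+\<omega>. ennreal (\<Psi> (f \<omega> / (R * c))) \<partial>M) \<le> (\<integral>\<^sup>+\<omega>. ennreal (1/R) * ennreal (\<Psi> (f \<omega> / c)) \<partial>M)"
  proof (intro nn_integral_mono)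
    fix \<omega>
    show "ennreal (\<Psi> (f \<omega> / (R * c))) \<le> ennreal (1/R) * ennreal (\<Psi> (f \<omega> / c))"
      using scale[of "1/R" "f \<omega> / c"] R(1) by (subst ennreal_mult[symmetric]) (auto intro: ennreal_leI)
  qed
  also have "\<dots> = ennreal (1/R * b)"
    using b R(1) by (subst ennreal_mult) (auto simp: nn_integral_cmult)
  also have "\<dots> \<le> 1"
    using R by (simp add: ennreal_le_1)
  finally have "f \<in> scaled_orlicz_ball (R * c) M \<Psi>"
    using assms R(1) by (simp add: scaled_ball_iff)
  moreover have "R * c > 0" using assms(2) R(1) by simp
  ultimately show ?thesis unfolding orlicz_space_def by blast
qed

end

section \<open>Conjugation and the growth condition \<open>\<Delta>\<^sub>2\<close>\<close>

text \<open>Superlinearity makes \<open>x * y - \<Phi> x\<close> nonpositive for large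
  \<open>\<bar>x\<bar>\<close>; elsewhere \<open>\<Phi> \<ge> 0\<close> leaves a multiple of
  \<open>\<bar>y\<bar>\<close>.\<close>

lemma conjugate_bdd_above:
  assumes "young_function \<Phi>"
  shows "bdd_above (range (\<lambda>x. x * y - \<Phi> x))"
proof -
  interpret even_convex \<Phi> using assms by unfold_locales (auto simp: young_function_def)
  have "eventually (\<lambda>x. \<bar>y\<bar> \<le> \<Phi> x / x) at_top"
    using assms by (auto simp: young_function_def filterlim_at_top)
  then obtain R where R: "\<And>x. x \<ge> R \<Longrightarrow> \<bar>y\<bar> \<le> \<Phi> x / x"
    by (auto simp: eventually_at_top_linorder)
  have "x * y - \<Phi> x \<le> max 1 R * \<bar>y\<bar>" for x
  proof (cases "\<bar>x\<bar> \<ge> max 1 R")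
    case True
    then have "\<bar>y\<bar> * \<bar>x\<bar> \<le> \<Phi> x" using R[of "\<bar>x\<bar>"] by (auto simp: field_simps)
    moreover have "x * y \<le> \<bar>y\<bar> * \<bar>x\<bar>" by (metis abs_ge_self abs_mult mult.commute)
    ultimately show ?thesis by (smt (verit) mult_nonneg_nonneg)
  next
    case False
    have "x * y \<le> \<bar>x\<bar> * \<bar>y\<bar>" by (metis abs_ge_self abs_mult)
    also have "\<dots> \<le> max 1 R * \<bar>y\<bar>" using False by (intro mult_right_mono) auto
    finally show ?thesis using nonneg[of x] by linarith
  qed
  then show ?thesis by (intro bdd_aboveI) auto
qed

lemma conjugate_ge:
  assumes "young_function \<Phi>"
  shows "x * y - \<Phi> x \<le> young_conjugate \<Phi> y"
  unfolding young_conjugate_def by (intro cSUP_upper conjugate_bdd_above assms) simp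

lemma conjugate_least: "(\<And>x. x * y - \<Phi> x \<le> b) \<Longrightarrow> young_conjugate \<Phi> y \<le> b"
  unfolding young_conjugate_def by (intro cSUP_least) auto

text \<open>A supremum of affine functions of \<open>y\<close> is convex. Evenness comes from
  replacing \<open>x\<close> by \<open>- x\<close>, and the value at 0 from
  \<open>- \<Phi> x \<le> 0\<close> with equality at \<open>x = 0\<close>.\<close>

lemma even_convex_conjugate:
  assumes "young_function \<Phi>"
  shows "even_convex (young_conjugate \<Phi>)"
proof -
  interpret even_convex \<Phi> using assms by unfold_locales (auto simp: young_function_def)
  have le: "young_conjugate \<Phi> (- y) \<le> young_conjugate \<Phi> y" for y
    by (rule conjugate_least) (use conjugate_ge[OF assms, of "- _" y] even in auto)
  show ?thesis
  proof
    fix y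
    show "young_conjugate \<Phi> (- y) = young_conjugate \<Phi> y"
      using le[of y] le[of "- y"] by simp
  next
    show "convex_on UNIV (young_conjugate \<Phi>)"
    proof (intro convex_onI)
      fix t x y :: real
      assume t: "0 < t" "t < 1"
      show "young_conjugate \<Phi> ((1 - t) *\<^sub>R x + t *\<^sub>R y)
          \<le> (1 - t) * young_conjugate \<Phi> x + t * young_conjugate \<Phi> y"
      proof (rule conjugate_least)
        fix z
        have "z * ((1 - t) *\<^sub>R x + t *\<^sub>R y) - \<Phi> z = (1 - t) * (z * x - \<Phi> z) + t * (z * y - \<Phi> z)"
          by (simp add: algebra_simps)
        also have "\<dots> \<le> (1 - t) * young_conjugate \<Phi> x + t * young_conjugate \<Phi> y"
          using t by (intro add_mono mult_left_mono conjugate_ge assms) auto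
        finally show "z * ((1 - t) *\<^sub>R x + t *\<^sub>R y) - \<Phi> z
          \<le> (1 - t) * young_conjugate \<Phi> x + t * young_conjugate \<Phi> y" .
      qed
    qed simp
  next
    have "young_conjugate \<Phi> 0 \<le> 0" by (rule conjugate_least) simp
    then show "young_conjugate \<Phi> 0 = 0" using conjugate_ge[OF assms, of 0 0] zero by simp
  qed
qed

text \<open>The finite limsup bounds the quotient eventually, and superlinearity makes
  \<open>\<Phi>\<close> positive there, so the denominator can be cleared.\<close>

lemma Delta2_eventually:
  assumes "young_function \<Phi>" "Delta2 \<Phi>"
  obtains K x0 where "K > 2" "x0 > 0" "\<And>x. x \<ge> x0 \<Longrightarrow> \<Phi> (2 * x) \<le> K * \<Phi> x"
proof -
  obtain C :: nat where "Limsup at_top (\<lambda>x. ereal (\<Phi> (2 * x) / \<Phi> x)) < ereal (real C)"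
    using assms(2) unfolding Delta2_def by (auto simp: less_PInf_Ex_of_nat)
  then have "eventually (\<lambda>x. ereal (\<Phi> (2 * x) / \<Phi> x) < ereal (real C)) at_top"
    by (rule Limsup_lessD)
  moreover have "eventually (\<lambda>x. 1 \<le> \<Phi> x / x) at_top"
    using assms(1) by (auto simp: young_function_def filterlim_at_top)
  ultimately have "eventually (\<lambda>x. \<Phi> (2 * x) / \<Phi> x < C \<and> 1 \<le> \<Phi> x / x) at_top"
    by eventually_elim auto
  then obtain x0 where x0: "\<And>x. x \<ge> x0 \<Longrightarrow> \<Phi> (2 * x) / \<Phi> x < C \<and> 1 \<le> \<Phi> x / x"
    by (auto simp: eventually_at_top_linorder)
  show thesis
  \<comment> \<open>The 3 enforces \<open>K > 2\<close>, so that the factor \<open>K / 2\<close> in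
    the dual condition exceeds 1.\<close>
  proof (rule that[of "max C 3" "max x0 1"])
    fix x assume x: "max x0 1 \<le> x"
    then have "\<Phi> x > 0" using x0[of x] by (auto simp: field_simps)
    moreover have "\<Phi> (2 * x) / \<Phi> x < max C 3" using x0[of x] x by auto
    ultimately show "\<Phi> (2 * x) \<le> max C 3 * \<Phi> x" by (simp add: field_simps)
  qed auto
qed

text \<open>The condition dual to \<open>\<Delta>\<^sub>2\<close>, with \<open>a = K / 2\<close>.
  The point \<open>2 * x\<close> in the supremum at \<open>a * y\<close> contributes at least
  \<open>K * (x * y - \<Phi> x)\<close> when \<open>x \<ge> x0\<close>, and
  \<open>K = 2 * a\<close>.\<close>

lemma conjugate_nabla2:
  assumes "young_function \<Phi>" "Delta2 \<Phi>"
  obtains a y0 where "a > 1" "y0 > 0"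
    "\<forall>y\<ge>y0. 2 * a * young_conjugate \<Phi> y \<le> young_conjugate \<Phi> (a * y)"
proof -
  interpret even_convex \<Phi> using assms by unfold_locales (auto simp: young_function_def)
  obtain K x0 where K: "K > 2" "x0 > 0" "\<And>x. x \<ge> x0 \<Longrightarrow> \<Phi> (2 * x) \<le> K * \<Phi> x"
    using Delta2_eventually[OF assms] by blast
  \<comment> \<open>From \<open>y0\<close> on, \<open>\<Phi> (4 * x0) \<le> K * x0 * y\<close>. The
    summand 1 keeps \<open>y0\<close> positive.\<close>
  define y0 where "y0 = (\<Phi> (4 * x0) + 1) / (K * x0)"
  have y0: "y0 > 0" using K by (auto simp: y0_def add_nonneg_pos)
  show thesis
  proof (rule that[of "K / 2" y0])
    have "2 * (K / 2) * young_conjugate \<Phi> y \<le> young_conjugate \<Phi> (K / 2 * y)" if y: "y \<ge> y0" for y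
    proof -
      have *: "x * y - \<Phi> x \<le> young_conjugate \<Phi> (K / 2 * y) / K" for x
      proof (cases "x \<ge> x0")
        case True
        have "K * (x * y - \<Phi> x) \<le> (2 * x) * (K / 2 * y) - \<Phi> (2 * x)"
          using K(3)[OF True] by (simp add: algebra_simps)
        also have "\<dots> \<le> young_conjugate \<Phi> (K / 2 * y)"
          by (rule conjugate_ge[OF assms(1)])
        finally show ?thesis using K by (simp add: field_simps)
      next
        case False
        \<comment> \<open>Below \<open>x0\<close> doubling is not controlled. The single test point
          \<open>4 * x0\<close> serves all these \<open>x\<close>: half of its linear term pays for
          \<open>\<Phi> (4 * x0)\<close>, the other half dominates \<open>K * x * y\<close>.\<close>
        have "\<Phi> (4 * x0) \<le> K * x0 * y"
          using y K by (simp add: y0_def field_simps)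
        moreover have "K * (x * y) \<le> K * (x0 * y)"
          using False y y0 K by (intro mult_left_mono mult_right_mono) auto
        moreover have "0 \<le> K * \<Phi> x" using K by simp
        ultimately have "K * (x * y - \<Phi> x) \<le> (4 * x0) * (K / 2 * y) - \<Phi> (4 * x0)"
          by (simp add: algebra_simps)
        also have "\<dots> \<le> young_conjugate \<Phi> (K / 2 * y)"
          by (rule conjugate_ge[OF assms(1)])
        finally show ?thesis using K by (simp add: field_simps)
      qed
      show ?thesis
        using conjugate_least[of y \<Phi>, OF *] K by (simp add: field_simps)
    qed
    then show "\<forall>y\<ge>y0. 2 * (K / 2) * young_conjugate \<Phi> y \<le> young_conjugate \<Phi> (K / 2 * y)"
      by blast
  qed (use K y0 in auto)
qed

text \<open>The exponent \<open>p\<close> with \<open>a powr p = 2 * a\<close> exceeds 1, so that the weights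
  \<open>(n + 1) powr (- p)\<close> are summable.\<close>

lemma (in even_convex) nabla2_imp_summable_weights:
  assumes "a > 1" "y0 > 0" and nabla: "\<forall>y\<ge>y0. 2 * a * \<Psi> y \<le> \<Psi> (a * y)"
  obtains w :: "nat \<Rightarrow> real" where "summable w" "\<And>n. 0 \<le> w n"
    "\<forall>n x. x / (real n + 1) \<ge> y0 \<longrightarrow> \<Psi> (x / (real n + 1)) \<le> w n * \<Psi> x"
proof -
  have iter: "(2 * a) ^ k * \<Psi> y \<le> \<Psi> (a ^ k * y)" if "y \<ge> y0" for k y
  proof (induction k)
    case (Suc k)
    have "1 * y \<le> a ^ k * y" using assms that by (intro mult_right_mono) auto
    with that have "2 * a * \<Psi> (a ^ k * y) \<le> \<Psi> (a * (a ^ k * y))"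
      by (intro nabla[rule_format]) auto
    moreover have "2 * a * ((2 * a) ^ k * \<Psi> y) \<le> 2 * a * \<Psi> (a ^ k * y)"
      using Suc assms by (intro mult_left_mono) auto
    ultimately show ?case by (simp add: mult_ac)
  qed simp
  define p where "p = log a (2 * a)"
  have p: "a powr p = 2 * a" "p > 1"
    using assms by (auto simp: p_def)
  \<comment> \<open>The factor \<open>a powr p\<close> pays for rounding
    \<open>log a (n + 1)\<close> down to an integer.\<close>
  define w where "w n = a powr p * real (Suc n) powr (- p)" for n
  have "summable (\<lambda>n. real n powr (- p))"
    using p by (simp add: summable_real_powr_iff)
  then have "summable (\<lambda>n. real (Suc n) powr (- p))"
    by (subst summable_Suc_iff)
  then have "summable w" unfolding w_def by (rule summable_mult)
  moreover have "0 \<le> w n" for n by (simp add: w_def)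
  moreover have "\<Psi> (x / (real n + 1)) \<le> w n * \<Psi> x" if x: "x / (real n + 1) \<ge> y0" for n x
  proof -
    let ?m = "real (Suc n)"
    have m: "?m > 0" by simp
    have "log a ?m \<ge> 0" using assms by simp
    \<comment> \<open>The largest \<open>k\<close> with \<open>a ^ k \<le> n + 1\<close>. Then
      \<open>x / a ^ k\<close> is still above \<open>y0\<close>, and \<open>k\<close> applications
      of \<open>nabla\<close> lead from there to \<open>x\<close>.\<close>
    define k where "k = nat \<lfloor>log a ?m\<rfloor>"
    have k: "real k \<le> log a ?m" "log a ?m \<le> real k + 1"
      using \<open>log a ?m \<ge> 0\<close> by (auto simp: k_def)
    have ak: "a ^ k \<le> ?m"
      using k(1) assms by (simp add: le_log_iff powr_realpow)
    have xpos: "x > 0"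
    proof -
      have "x = x / (real n + 1) * (real n + 1)" by simp
      also have "\<dots> > 0" using x assms(2) by (intro mult_pos_pos) auto
      finally show ?thesis .
    qed
    have le: "x / ?m \<le> x / a ^ k"
      using ak xpos assms by (intro divide_left_mono) auto
    have x': "x / ?m \<ge> y0" using x by (simp add: add.commute)
    have "(2 * a) ^ k * \<Psi> (x / ?m) \<le> (2 * a) ^ k * \<Psi> (x / a ^ k)"
      using le assms xpos by (intro mult_left_mono mono) auto
    also have "\<dots> \<le> \<Psi> (a ^ k * (x / a ^ k))"
      using le x' by (intro iter) auto
    also have "\<dots> = \<Psi> x" using assms by simp
    finally have 1: "(2 * a) ^ k * \<Psi> (x / ?m) \<le> \<Psi> x" .
    have "?m powr p = a powr (p * log a ?m)"
      using assms by (metis m less_irrefl less_trans mult.commute powr_log_cancel powr_powr zero_less_one)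
    also have "\<dots> \<le> a powr (p * (real k + 1))"
      using k p assms by (intro powr_mono mult_left_mono) auto
    also have "\<dots> = a powr p * (2 * a) ^ k"
      using assms p(1) by (simp add: distrib_left powr_add powr_powr[symmetric] powr_realpow)
    finally have "?m powr p * \<Psi> (x / ?m) \<le> a powr p * (2 * a) ^ k * \<Psi> (x / ?m)"
      by (intro mult_right_mono) auto
    also have "\<dots> \<le> a powr p * \<Psi> x"
      using 1 by (simp add: mult.assoc mult_left_mono)
    finally have "\<Psi> (x / ?m) \<le> w n * \<Psi> x"
      by (simp add: w_def powr_minus field_simps)
    then show ?thesis by (simp add: add.commute)
  qed
  ultimately show thesis by (intro that) auto
qed

section \<open>Almost surely convergent and sparse subsequences\<close>

text \<open>Indices are chosen where a deviation above \<open>(1/2)^n\<close> has probability below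
  \<open>(1/2)^n\<close>. By Borel-Cantelli almost every point meets finitely many of these events,
  and the thresholds tend to 0.\<close>

lemma (in prob_space) tendsto_in_prob_imp_AE_subseq:
  assumes [measurable]: "\<And>n. X n \<in> borel_measurable M" "Y \<in> borel_measurable M"
    and lim: "tendsto_in_prob M X Y"
  obtains u :: "nat \<Rightarrow> nat" where "strict_mono u" "AE \<omega> in M. (\<lambda>n. X (u n) \<omega>) \<longlonglongrightarrow> Y \<omega>"
proof -
  let ?A = "\<lambda>n m. {\<omega> \<in> space M. \<bar>X m \<omega> - Y \<omega>\<bar> > (1/2)^n}"
  have ex: "\<exists>m>k. prob (?A n m) < (1/2)^n" for k n
  proof -
    have "(\<lambda>m. prob (?A n m)) \<longlonglongrightarrow> 0"
      using lim by (simp add: tendsto_in_prob_def)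
    then have "eventually (\<lambda>m. prob (?A n m) < (1/2)^n) sequentially"
      by (rule order_tendstoD) simp
    from eventually_happens'[OF sequentially_bot eventually_conj[OF eventually_gt_at_top[of k] this]]
    show ?thesis .
  qed
  have "\<exists>u. \<forall>n. prob (?A n (u n)) < (1/2)^n \<and> u n < u (Suc n)"
  proof (rule dependent_nat_choice)
    show "\<exists>x. prob (?A 0 x) < (1/2)^0" using ex[of _ 0] by blast
  qed (use ex in blast)
  then obtain u where u: "\<And>n. prob (?A n (u n)) < (1/2)^n" "\<And>n. u n < u (Suc n)"
    by blast
  have "AE \<omega> in M. eventually (\<lambda>n. \<omega> \<in> space M - ?A n (u n)) sequentially"
  proof (rule borel_cantelli_AE1)
    show "summable (\<lambda>n. prob (?A n (u n)))"
      by (rule summable_comparison_test'[of "\<lambda>n. (1/2)^n" 0])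
        (use u(1) in \<open>auto intro: less_imp_le simp: summable_geometric\<close>)
  qed (auto simp: emeasure_eq_measure)
  then have "AE \<omega> in M. (\<lambda>n. X (u n) \<omega>) \<longlonglongrightarrow> Y \<omega>"
  proof eventually_elim
    case (elim \<omega>)
    then have "eventually (\<lambda>n. norm (X (u n) \<omega> - Y \<omega>) \<le> (1/2)^n) sequentially"
      by eventually_elim auto
    moreover have "(\<lambda>n. (1/2)^n :: real) \<longlonglongrightarrow> 0" by (intro LIMSEQ_realpow_zero) auto
    ultimately have "(\<lambda>n. X (u n) \<omega> - Y \<omega>) \<longlonglongrightarrow> 0" by (rule Lim_null_comparison)
    then show ?case by (simp add: LIM_zero_iff)
  qed
  then show thesis using u(2) by (intro that[of u]) (auto simp: strict_mono_Suc_iff)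
qed

text \<open>For fixed \<open>k\<close>, almost every point eventually leaves
  \<open>{z m > 1}\<close>, so dominated convergence with majorant \<open>F k\<close> sends the
  integral to 0 as \<open>m\<close> grows. The next index can thus be chosen knowing only the
  current one.\<close>

lemma subseq_small_integrals:
  fixes F :: "nat \<Rightarrow> 'a \<Rightarrow> ennreal" and z :: "nat \<Rightarrow> 'a \<Rightarrow> real"
  assumes [measurable]: "\<And>n. F n \<in> borel_measurable M" "\<And>n. z n \<in> borel_measurable M"
    and fin: "\<And>n. (\<integral>\<^sup>+\<omega>. F n \<omega> \<partial>M) < \<infinity>"
    and lim: "AE \<omega> in M. (\<lambda>n. z n \<omega>) \<longlonglongrightarrow> 0"
  obtains r :: "nat \<Rightarrow> nat" where "strict_mono r"
    "\<And>n. (\<integral>\<^sup>+\<omega>. F (r n) \<omega> * indicator {\<omega>. z (r (Suc n)) \<omega> > 1} \<omega> \<partial>M) \<le> ennreal ((1/2)^n)"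
proof -
  let ?I = "\<lambda>k m. \<integral>\<^sup>+\<omega>. F k \<omega> * indicator {\<omega>. z m \<omega> > 1} \<omega> \<partial>M"
  have ex: "\<exists>m>k. ?I k m \<le> ennreal ((1/2)^n)" for k n
  proof -
    have "?I k \<longlonglongrightarrow> (\<integral>\<^sup>+\<omega>. 0 \<partial>M)"
    proof (rule nn_integral_dominated_convergence[where w = "F k"])
      show "AE \<omega> in M. (\<lambda>m. F k \<omega> * indicator {\<omega>. z m \<omega> > 1} \<omega>) \<longlonglongrightarrow> 0"
        using lim
      proof eventually_elim
        case (elim \<omega>)
        then have "eventually (\<lambda>m. z m \<omega> < 1) sequentially" by (rule order_tendstoD) simp
        then have "eventually (\<lambda>m. F k \<omega> * indicator {\<omega>. z m \<omega> > 1} \<omega> = 0) sequentially"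
          by eventually_elim (auto simp: indicator_def)
        then show ?case by (rule tendsto_eventually)
      qed
    qed (auto simp: fin[unfolded infinity_ennreal_def] indicator_def)
    then have "eventually (\<lambda>m. ?I k m < ennreal ((1/2)^n)) sequentially"
      by (rule order_tendstoD) simp
    from eventually_happens'[OF sequentially_bot eventually_conj[OF eventually_gt_at_top[of k] this]]
    obtain m where "m > k" "?I k m < ennreal ((1/2)^n)" by (elim exE conjE)
    then show ?thesis by (intro exI[of _ m] conjI less_imp_le)
  qed
  \<comment> \<open>\<open>True\<close> fills the slot of \<open>dependent_nat_choice\<close> for a
    property of single elements; only the relation between successive indices matters.\<close>
  have "\<exists>r. \<forall>n::nat. True \<and> (r n < r (Suc n) \<and> ?I (r n) (r (Suc n)) \<le> ennreal ((1/2)^n))"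
    by (rule dependent_nat_choice) (use ex in simp_all)
  then obtain r :: "nat \<Rightarrow> nat"
    where r: "\<forall>n. True \<and> (r n < r (Suc n) \<and> ?I (r n) (r (Suc n)) \<le> ennreal ((1/2)^n))" ..
  show thesis by (rule that[of r]) (use r in \<open>simp_all add: strict_mono_Suc_iff\<close>)
qed

section \<open>The maximal function of the Cesaro means\<close>

text \<open>Applied at a single point of the sample space, with
  \<open>ennreal (\<Psi> x) \<le> H \<omega>\<close> for \<open>P x\<close>. If \<open>m\<close> is
  the last large index below \<open>N\<close>, then \<open>P\<close> holds for the terms before
  \<open>m\<close>, those after it are at most 1, and \<open>N \<ge> m + 1\<close>.\<close>

lemma mean_le_split:
  fixes z :: "nat \<Rightarrow> real"
  assumes nonneg: "\<And>i. 0 \<le> z i" and "0 < N" "P 1"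
    and P: "\<forall>j. z j > 1 \<longrightarrow> (\<forall>i<j. P (z i))"
  obtains b m where "P b" "0 \<le> b" "(\<Sum>i<N. z i) / real N \<le> b + z m / (real m + 1)"
proof (cases "\<exists>i<N. z i > 1")
  case False
  have "(\<Sum>i<N. z i) \<le> real N * 1"
    using sum_bounded_above[of "{..<N}" z 1] False by force
  then have "(\<Sum>i<N. z i) / real N \<le> 1" using assms(2) by (simp add: field_simps)
  \<comment> \<open>Without a large term the bound \<open>b = 1\<close> suffices, and
    \<open>m = 0\<close> is an arbitrary choice.\<close>
  then show thesis
    using that[of 1 0] nonneg[of 0] \<open>P 1\<close> by simp
next
  case True
  define m where "m = Max {i. i < N \<and> z i > 1}"
  have "m \<in> {i. i < N \<and> z i > 1}" unfolding m_def by (intro Max_in) (use True in auto)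
  then have m: "m < N" "z m > 1" by auto
  have last: "i \<le> m" if "i < N" "z i > 1" for i
    unfolding m_def by (intro Max_ge) (use that in auto)
  \<comment> \<open>The element 1 covers the terms after \<open>m\<close> and keeps \<open>B\<close>
    nonempty if \<open>m = 0\<close>. The maximum \<open>b\<close> is itself in \<open>B\<close>,
    whence \<open>P b\<close>.\<close>
  define B where "B = insert 1 (z ` {..<m})"
  define b where "b = Max B"
  have "finite B" "B \<noteq> {}" by (auto simp: B_def)
  then have "b \<in> B" and b: "\<And>x. x \<in> B \<Longrightarrow> x \<le> b" by (auto simp: b_def)
  from b have "b \<ge> 1" by (auto simp: B_def)
  have zb: "z i \<le> b" if "i < N" "i \<noteq> m" for i
  proof (cases "i < m")
    case False
    then show ?thesis using last[of i] that \<open>b \<ge> 1\<close> by force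
  qed (auto intro!: b simp: B_def)
  have "(\<Sum>i<N. z i) = z m + (\<Sum>i\<in>{..<N} - {m}. z i)"
    using m by (simp add: sum.remove)
  also have "(\<Sum>i\<in>{..<N} - {m}. z i) \<le> (\<Sum>i\<in>{..<N} - {m}. b)"
    using zb by (intro sum_mono) auto
  also have "\<dots> \<le> (\<Sum>i<N. b)"
    using \<open>b \<ge> 1\<close> by (intro sum_mono2) auto
  finally have "(\<Sum>i<N. z i) / real N \<le> (z m + real N * b) / real N"
    by (intro divide_right_mono) auto
  also have "\<dots> = b + z m / real N" using assms(2) by (simp add: field_simps)
  also have "z m / real N \<le> z m / (real m + 1)"
    using m by (intro divide_left_mono) auto
  finally have "(\<Sum>i<N. z i) / real N \<le> b + z m / (real m + 1)" by simp
  moreover have "P b"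
    using \<open>b \<in> B\<close> \<open>P 1\<close> P m(2) by (auto simp: B_def)
  ultimately show thesis using that \<open>b \<ge> 1\<close> by force
qed

text \<open>The order of choice matters: \<open>r\<close> is fixed before \<open>s\<close>, while
  the integrable majorant \<open>H\<close> may depend on \<open>s\<close> but not on
  \<open>N\<close>.\<close>

lemma (in even_convex) maximal_cesaro_dominated:
  fixes z :: "nat \<Rightarrow> 'a \<Rightarrow> real" and w :: "nat \<Rightarrow> real"
  assumes "prob_space M"
    and [measurable]: "\<And>n. z n \<in> borel_measurable M"
    and z_nonneg: "\<And>n \<omega>. 0 \<le> z n \<omega>"
    and modular: "\<And>n. (\<integral>\<^sup>+\<omega>. ennreal (\<Psi> (z n \<omega>)) \<partial>M) \<le> 1"
    and lim: "AE \<omega> in M. (\<lambda>n. z n \<omega>) \<longlonglongrightarrow> 0"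
    and w: "summable w" "\<And>n. 0 \<le> w n"
    and "y0 > 0"
    and weight: "\<forall>n x. x / (real n + 1) \<ge> y0 \<longrightarrow> \<Psi> (x / (real n + 1)) \<le> w n * \<Psi> x"
  obtains r :: "nat \<Rightarrow> nat" where "strict_mono r"
    "\<And>s :: nat \<Rightarrow> nat. strict_mono s \<Longrightarrow> \<exists>H \<in> borel_measurable M. (\<integral>\<^sup>+\<omega>. H \<omega> \<partial>M) < \<infinity> \<and>
      (\<forall>\<omega>. \<forall>N>0. ennreal (\<Psi> ((\<Sum>i<N. z (r (s i)) \<omega>) / real N / 2)) \<le> H \<omega>)"
proof -
  interpret prob_space M by fact
  \<comment> \<open>Summing over all indices up to \<open>k\<close>, not just the selected ones,
    lets one choice of \<open>r\<close> serve every further subsequence.\<close>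
  define F where "F k \<omega> = (\<Sum>i\<le>k. ennreal (\<Psi> (z i \<omega>)))" for k \<omega>
  have F_meas [measurable]: "F k \<in> borel_measurable M" for k unfolding F_def by measurable
  have F_fin: "(\<integral>\<^sup>+\<omega>. F k \<omega> \<partial>M) < \<infinity>" for k
  proof -
    have "(\<integral>\<^sup>+\<omega>. F k \<omega> \<partial>M) = (\<Sum>i\<le>k. \<integral>\<^sup>+\<omega>. ennreal (\<Psi> (z i \<omega>)) \<partial>M)"
      unfolding F_def by (rule nn_integral_sum) measurable
    also have "\<dots> \<le> (\<Sum>i\<le>k. 1)" by (intro sum_mono modular)
    also have "\<dots> < \<infinity>" by (simp add: of_nat_less_top)
    finally show ?thesis .
  qed
  obtain r where r: "strict_mono r" and
    rI: "\<And>n. (\<integral>\<^sup>+\<omega>. F (r n) \<omega> * indicator {\<omega>. z (r (Suc n)) \<omega> > 1} \<omega> \<partial>M) \<le> ennreal ((1/2)^n)"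
    using that by (rule subseq_small_integrals[of F M z, OF F_meas assms(2) F_fin lim])
  define G where "G \<omega> = (\<Sum>n. F (r n) \<omega> * indicator {\<omega>. z (r (Suc n)) \<omega> > 1} \<omega>)" for \<omega>
  have [measurable]: "G \<in> borel_measurable M" unfolding G_def by measurable
  have "(\<integral>\<^sup>+\<omega>. G \<omega> \<partial>M) = (\<Sum>n. \<integral>\<^sup>+\<omega>. F (r n) \<omega> * indicator {\<omega>. z (r (Suc n)) \<omega> > 1} \<omega> \<partial>M)"
    unfolding G_def by (subst nn_integral_suminf) auto
  also have "\<dots> \<le> (\<Sum>n. ennreal ((1/2)^n))"
    by (intro suminf_le rI) auto
  also have "\<dots> = ennreal (\<Sum>n. (1/2)^n)"
    by (intro suminf_ennreal2 summable_geometric) auto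
  also have "\<dots> < \<infinity>" by (simp only: infinity_ennreal_def ennreal_less_top)
  finally have G_fin: "(\<integral>\<^sup>+\<omega>. G \<omega> \<partial>M) < \<infinity>" .
  show thesis
  proof (rule that[OF r])
    fix s :: "nat \<Rightarrow> nat" assume s: "strict_mono s"
    \<comment> \<open>The weight belongs to the position \<open>n\<close> after thinning by
      \<open>s\<close>, so \<open>W\<close> is built separately for each \<open>s\<close>. The
      modular bound 1 makes its integral at most the sum of \<open>w\<close>.\<close>
    define W where "W \<omega> = (\<Sum>n. ennreal (w n) * ennreal (\<Psi> (z (r (s n)) \<omega>)))" for \<omega>
    have [measurable]: "W \<in> borel_measurable M" unfolding W_def by measurable
    have "(\<integral>\<^sup>+\<omega>. W \<omega> \<partial>M) = (\<Sum>n. ennreal (w n) * (\<integral>\<^sup>+\<omega>. ennreal (\<Psi> (z (r (s n)) \<omega>)) \<partial>M))"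
      unfolding W_def by (subst nn_integral_suminf) (auto simp: nn_integral_cmult)
    also have "\<dots> \<le> (\<Sum>n. ennreal (w n) * 1)"
      by (intro suminf_le mult_left_mono modular) auto
    also have "\<dots> = ennreal (\<Sum>n. w n)"
      using w by (simp only: mult_1_right suminf_ennreal2)
    also have "\<dots> < \<infinity>" by (simp only: infinity_ennreal_def ennreal_less_top)
    finally have W_fin: "(\<integral>\<^sup>+\<omega>. W \<omega> \<partial>M) < \<infinity>" .
    define H where "H \<omega> = ennreal (\<Psi> 1) + ennreal (\<Psi> y0) + G \<omega> + W \<omega>" for \<omega>
    have le_H: "ennreal (\<Psi> 1) \<le> H \<omega>" "ennreal (\<Psi> y0) \<le> H \<omega>" "G \<omega> \<le> H \<omega>" "W \<omega> \<le> H \<omega>" for \<omega>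
      unfolding H_def by (auto intro: add_increasing add_increasing2 simp: add.assoc)
    show "\<exists>H \<in> borel_measurable M. (\<integral>\<^sup>+\<omega>. H \<omega> \<partial>M) < \<infinity> \<and>
      (\<forall>\<omega>. \<forall>N>0. ennreal (\<Psi> ((\<Sum>i<N. z (r (s i)) \<omega>) / real N / 2)) \<le> H \<omega>)"
    proof (intro bexI[of _ H] conjI allI impI)
      show "H \<in> borel_measurable M" unfolding H_def by measurable
      show "(\<integral>\<^sup>+\<omega>. H \<omega> \<partial>M) < \<infinity>"
        using G_fin W_fin by (simp add: H_def nn_integral_add emeasure_space_1)
    next
      fix \<omega> and N :: nat
      assume N: "N > 0"
      have early: "\<forall>j. z (r (s j)) \<omega> > 1 \<longrightarrow> (\<forall>i<j. ennreal (\<Psi> (z (r (s i)) \<omega>)) \<le> H \<omega>)"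
      proof (intro allI impI)
        fix i j :: nat
        assume large: "z (r (s j)) \<omega> > 1" and "i < j"
        from s this(2) have "s i < s j" by (simp add: strict_mono_def)
        \<comment> \<open>Being larger than \<open>s i\<close>, \<open>s j\<close> is a successor.
          The indicator in summand \<open>l\<close> of \<open>G\<close> is 1 at this point, and
          \<open>F (r l)\<close> contains the term of index \<open>r (s i)\<close>.\<close>
        then obtain l where l: "s j = Suc l" "s i \<le> l" by (cases "s j") auto
        have "ennreal (\<Psi> (z (r (s i)) \<omega>)) \<le> F (r l) \<omega>"
          unfolding F_def using l r
          by (intro member_le_sum[of _ _ "\<lambda>i. ennreal (\<Psi> (z i \<omega>))"]) (auto simp: strict_mono_less_eq)
        also have "\<dots> = (\<Sum>n\<in>{l}. F (r n) \<omega> * indicator {\<omega>. z (r (Suc n)) \<omega> > 1} \<omega>)"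
          using large l by simp
        also have "\<dots> \<le> G \<omega>" unfolding G_def by (intro sum_le_suminf) auto
        finally show "ennreal (\<Psi> (z (r (s i)) \<omega>)) \<le> H \<omega>" using le_H(3) by (rule order_trans)
      qed
      obtain b m where b: "ennreal (\<Psi> b) \<le> H \<omega>" "0 \<le> b" and
        le: "(\<Sum>i<N. z (r (s i)) \<omega>) / real N \<le> b + z (r (s m)) \<omega> / (real m + 1)"
        using mean_le_split[of "\<lambda>i. z (r (s i)) \<omega>" N "\<lambda>x. ennreal (\<Psi> x) \<le> H \<omega>",
          OF z_nonneg N le_H(1) early] by blast
      define t where "t = z (r (s m)) \<omega> / (real m + 1)"
      have "t \<ge> 0" using z_nonneg by (simp add: t_def)
      have t: "ennreal (\<Psi> t) \<le> H \<omega>"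
      \<comment> \<open>The weights act only above \<open>y0\<close>; the constant
        \<open>\<Psi> y0\<close> in \<open>H\<close> covers smaller \<open>t\<close>.\<close>
      proof (cases "t \<ge> y0")
        case True
        have "ennreal (\<Psi> t) \<le> ennreal (w m * \<Psi> (z (r (s m)) \<omega>))"
          using weight True unfolding t_def by (blast intro: ennreal_leI)
        also have "\<dots> = (\<Sum>n\<in>{m}. ennreal (w n) * ennreal (\<Psi> (z (r (s n)) \<omega>)))"
          using w by (simp add: ennreal_mult)
        also have "\<dots> \<le> W \<omega>" unfolding W_def by (intro sum_le_suminf) auto
        finally show ?thesis using le_H(4) by (rule order_trans)
      next
        case False
        then have "\<Psi> t \<le> \<Psi> y0" using \<open>t \<ge> 0\<close> by (intro mono) auto
        then show ?thesis using le_H(2)[of \<omega>] by (meson ennreal_leI order_trans)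
      qed
      define q where "q = (\<Sum>i<N. z (r (s i)) \<omega>) / real N"
      have "q \<ge> 0" unfolding q_def by (intro divide_nonneg_nonneg sum_nonneg z_nonneg) simp
      moreover have "q \<le> b + t" using le by (simp only: q_def t_def)
      \<comment> \<open>The halving pays off here: \<open>(b + t) / 2 \<le> max b t\<close>, which
        avoids a doubling constant for \<open>\<Psi>\<close>.\<close>
      ultimately have "\<bar>q / 2\<bar> \<le> \<bar>max b t\<bar>" using \<open>t \<ge> 0\<close> b(2) by linarith
      then have "ennreal (\<Psi> (q / 2)) \<le> ennreal (\<Psi> (max b t))"
        by (intro ennreal_leI mono)
      also have "\<dots> \<le> H \<omega>" using b(1) t by (cases "b \<le> t") (simp_all add: max_def)
      finally show "ennreal (\<Psi> ((\<Sum>i<N. z (r (s i)) \<omega>) / real N / 2)) \<le> H \<omega>"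
        unfolding q_def .
    qed
  qed
qed

section \<open>Order convergence of the Cesaro means\<close>

lemma cesaro_tendsto:
  fixes f :: "nat \<Rightarrow> real"
  assumes "f \<longlonglongrightarrow> l"
  shows "(\<lambda>N. (1 / real N) * (\<Sum>i<N. f i)) \<longlonglongrightarrow> l"
proof (rule LIMSEQ_I)
  fix e :: real assume e: "e > 0"
  obtain n0 where n0: "\<And>i. i \<ge> n0 \<Longrightarrow> \<bar>f i - l\<bar> < e / 2"
    using LIMSEQ_D[OF assms, of "e / 2"] e by (auto simp: real_norm_def)
  define C where "C = (\<Sum>i<n0. \<bar>f i - l\<bar>)"
  have "(\<lambda>N. C / real N) \<longlonglongrightarrow> 0" by (rule lim_const_over_n)
  then have "eventually (\<lambda>N. C / real N < e / 2) sequentially"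
    by (rule order_tendstoD) (use e in simp)
  then obtain n1 where n1: "\<And>N. N \<ge> n1 \<Longrightarrow> C / real N < e / 2"
    by (auto simp: eventually_sequentially)
  have "norm ((1 / real N) * (\<Sum>i<N. f i) - l) < e" if N: "N \<ge> max 1 (max n0 n1)" for N
  proof -
    have "(1 / real N) * (\<Sum>i<N. f i) - l = (\<Sum>i<N. f i - l) / real N"
      using N by (simp add: sum_subtractf field_simps)
    then have "\<bar>(1 / real N) * (\<Sum>i<N. f i) - l\<bar> \<le> (\<Sum>i<N. \<bar>f i - l\<bar>) / real N"
      by (simp add: divide_right_mono sum_abs)
    also have "(\<Sum>i<N. \<bar>f i - l\<bar>) = C + (\<Sum>i=n0..<N. \<bar>f i - l\<bar>)"
      unfolding C_def using N by (simp add: lessThan_atLeast0 sum.atLeastLessThan_concat)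
    also have "(\<Sum>i=n0..<N. \<bar>f i - l\<bar>) \<le> (\<Sum>i=n0..<N. e / 2)"
      using n0 by (intro sum_mono) (auto intro: less_imp_le)
    also have "\<dots> \<le> real N * (e / 2)"
      using e by (simp add: mult_right_mono)
    finally have "\<bar>(1 / real N) * (\<Sum>i<N. f i) - l\<bar> \<le> (C + real N * (e / 2)) / real N"
      by (simp add: divide_right_mono)
    also have "\<dots> = C / real N + e / 2" using N by (simp add: field_simps)
    also have "\<dots> < e" using n1[of N] N by linarith
    finally show ?thesis by simp
  qed
  then show "\<exists>no. \<forall>N\<ge>no. norm ((1 / real N) * (\<Sum>i<N. f i) - l) < e" by blast
qed

theorem theorem3p6:
  fixes M :: "'a measure" and \<Phi> :: "real \<Rightarrow> real"
    and X :: "nat \<Rightarrow> 'a \<Rightarrow> real" and \<xi> :: "'a \<Rightarrow> real"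
  assumes "prob_space M"
    and "young_function \<Phi>"
    and "Delta2 \<Phi>"
    and "\<And>n. X n \<in> orlicz_space M (young_conjugate \<Phi>)"
    and "\<exists>C. \<forall>n. orlicz_norm M (young_conjugate \<Phi>) (X n) \<le> C"
    and "\<xi> \<in> orlicz_space M (young_conjugate \<Phi>)"
    and "tendsto_in_prob M X \<xi>"
  shows "\<exists>r :: nat \<Rightarrow> nat. strict_mono r \<and>
           (\<forall>s :: nat \<Rightarrow> nat. strict_mono s \<longrightarrow>
              ereal_mem_orlicz M (young_conjugate \<Phi>)
                (\<lambda>\<omega>. SUP N\<in>{1..}. ereal \<bar>cesaro_mean (\<lambda>i. X (r (s i))) N \<omega>\<bar>) \<and>
              (AE \<omega> in M. (\<lambda>N. cesaro_mean (\<lambda>i. X (r (s i))) N \<omega>) \<longlonglongrightarrow> \<xi> \<omega>))"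
proof -
  let ?\<Psi> = "young_conjugate \<Phi>"
  interpret prob_space M by fact
  interpret even_convex ?\<Psi> by (rule even_convex_conjugate[OF assms(2)])
  obtain C where C: "\<And>n. orlicz_norm M ?\<Psi> (X n) \<le> C" using assms(5) by blast
  obtain c where c: "c > 0" and \<xi>_ball: "\<xi> \<in> scaled_orlicz_ball c M ?\<Psi>"
    and X_ball: "\<And>n. X n \<in> scaled_orlicz_ball c M ?\<Psi>"
  proof
    \<comment> \<open>Strictly above all the norms involved, so that one radius serves the whole
      sequence and its limit.\<close>
    let ?d = "max C (orlicz_norm M ?\<Psi> \<xi>) + 1"
    have "orlicz_norm M ?\<Psi> \<xi> < ?d" by simp
    from orlicz_norm_less_imp_scaled_ball[OF assms(6) this]
    show "?d > 0" "\<xi> \<in> scaled_orlicz_ball ?d M ?\<Psi>" by auto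
    fix n
    have "orlicz_norm M ?\<Psi> (X n) < ?d" using C[of n] by simp
    from orlicz_norm_less_imp_scaled_ball(2)[OF assms(4) this]
    show "X n \<in> scaled_orlicz_ball ?d M ?\<Psi>" .
  qed
  have \<xi>_meas [measurable]: "\<xi> \<in> borel_measurable M"
    and \<xi>_mod: "(\<integral>\<^sup>+\<omega>. ennreal (?\<Psi> (\<xi> \<omega> / c)) \<partial>M) \<le> 1"
    using \<xi>_ball c by (auto simp: scaled_ball_iff)
  have X_meas [measurable]: "X n \<in> borel_measurable M" for n
    using X_ball c by (auto simp: scaled_ball_iff)
  obtain u where u: "strict_mono u" and X_lim: "AE \<omega> in M. (\<lambda>n. X (u n) \<omega>) \<longlonglongrightarrow> \<xi> \<omega>"
    using that by (rule tendsto_in_prob_imp_AE_subseq[OF X_meas \<xi>_meas assms(7)])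
  obtain a y0 where a: "a > 1" "y0 > 0"
    "\<forall>y\<ge>y0. 2 * a * ?\<Psi> y \<le> ?\<Psi> (a * y)"
    using that by (rule conjugate_nabla2[OF assms(2,3)])
  obtain w :: "nat \<Rightarrow> real" where w: "summable w" "\<And>n. 0 \<le> w n"
    "\<forall>n x. x / (real n + 1) \<ge> y0 \<longrightarrow> ?\<Psi> (x / (real n + 1)) \<le> w n * ?\<Psi> x"
    using that by (rule nabla2_imp_summable_weights[OF a])
  \<comment> \<open>The factor 2 comes from \<open>scaled_ball_diff\<close> and keeps the modular of
    every \<open>z n\<close> at most 1.\<close>
  define z where "z n \<omega> = \<bar>X (u n) \<omega> - \<xi> \<omega>\<bar> / (2 * c)" for n \<omega>
  have z_meas: "z n \<in> borel_measurable M" for n unfolding z_def by measurable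
  have z_nonneg: "0 \<le> z n \<omega>" for n \<omega> using c by (simp add: z_def)
  have z_mod: "(\<integral>\<^sup>+\<omega>. ennreal (?\<Psi> (z n \<omega>)) \<partial>M) \<le> 1" for n
  proof -
    have "?\<Psi> (z n \<omega>) = ?\<Psi> ((X (u n) \<omega> - \<xi> \<omega>) / (2 * c))" for \<omega>
      using abs_arg[of "(X (u n) \<omega> - \<xi> \<omega>) / (2 * c)"] c by (simp add: z_def)
    then show ?thesis
      using scaled_ball_diff[OF c X_ball[of "u n"] \<xi>_ball] c by (simp add: scaled_ball_iff)
  qed
  have z_lim: "AE \<omega> in M. (\<lambda>n. z n \<omega>) \<longlonglongrightarrow> 0"
    using X_lim
  proof eventually_elim
    case (elim \<omega>)
    then have "(\<lambda>n. \<bar>X (u n) \<omega> - \<xi> \<omega>\<bar> / (2 * c)) \<longlonglongrightarrow> \<bar>\<xi> \<omega> - \<xi> \<omega>\<bar> / (2 * c)"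
      using c by (intro tendsto_intros) auto
    then show ?case by (simp add: z_def)
  qed
  obtain r where r: "strict_mono r" and
    dom: "\<And>s :: nat \<Rightarrow> nat. strict_mono s \<Longrightarrow> \<exists>H \<in> borel_measurable M. (\<integral>\<^sup>+\<omega>. H \<omega> \<partial>M) < \<infinity> \<and>
      (\<forall>\<omega>. \<forall>N>0. ennreal (?\<Psi> ((\<Sum>i<N. z (r (s i)) \<omega>) / real N / 2)) \<le> H \<omega>)"
    using that by (rule maximal_cesaro_dominated[of M z w y0, OF assms(1) z_meas z_nonneg z_mod z_lim w(1,2) a(2) w(3)])
  have "ereal_mem_orlicz M ?\<Psi> (\<lambda>\<omega>. SUP N\<in>{1..}. ereal \<bar>cesaro_mean (\<lambda>i. X (u (r (s i)))) N \<omega>\<bar>)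
    \<and> (AE \<omega> in M. (\<lambda>N. cesaro_mean (\<lambda>i. X (u (r (s i)))) N \<omega>) \<longlonglongrightarrow> \<xi> \<omega>)"
    if s: "strict_mono s" for s :: "nat \<Rightarrow> nat"
  proof
    define Y where "Y = (\<lambda>i. X (u (r (s i))))"
    define m where "m N \<omega> = \<bar>cesaro_mean Y N \<omega>\<bar>" for N \<omega>
    have m_meas [measurable]: "m N \<in> borel_measurable M" for N
      unfolding m_def cesaro_mean_def Y_def by measurable
    have mean_lim: "AE \<omega> in M. (\<lambda>N. cesaro_mean Y N \<omega>) \<longlonglongrightarrow> \<xi> \<omega>"
      using X_lim
    proof eventually_elim
      case (elim \<omega>)
      from LIMSEQ_subseq_LIMSEQ[OF elim strict_mono_o[OF r s]]
      have "(\<lambda>i. Y i \<omega>) \<longlonglongrightarrow> \<xi> \<omega>" by (simp add: Y_def o_def)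
      then show ?case unfolding cesaro_mean_def by (rule cesaro_tendsto)
    qed
    then show "AE \<omega> in M. (\<lambda>N. cesaro_mean (\<lambda>i. X (u (r (s i)))) N \<omega>) \<longlonglongrightarrow> \<xi> \<omega>"
      by (simp add: Y_def)
    define E where "E \<omega> = (SUP N\<in>{1..}. ereal (m N \<omega>))" for \<omega>
    have E_meas [measurable]: "E \<in> borel_measurable M" unfolding E_def by measurable
    \<comment> \<open>\<open>real_of_ereal\<close> sends infinite values to 0, but \<open>E\<close>
      is infinite only on a null set, because convergent means are bounded.\<close>
    define \<eta> where "\<eta> \<omega> = real_of_ereal (E \<omega>)" for \<omega>
    have \<eta>_meas [measurable]: "\<eta> \<in> borel_measurable M" unfolding \<eta>_def by measurable
    have E_eq: "AE \<omega> in M. E \<omega> = ereal (\<eta> \<omega>)"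
      using mean_lim
    proof eventually_elim
      case (elim \<omega>)
      then obtain B where B: "\<And>N. m N \<omega> \<le> B"
        using convergent_imp_Bseq[OF convergentI] by (metis BseqE m_def real_norm_def)
      have "E \<omega> \<le> ereal B" unfolding E_def by (intro SUP_least) (simp add: B)
      moreover have "0 \<le> E \<omega>" unfolding E_def by (intro SUP_upper2[of 1]) (auto simp: m_def)
      ultimately show ?case unfolding \<eta>_def by (cases "E \<omega>") auto
    qed
    obtain H where [measurable]: "H \<in> borel_measurable M" and H_fin: "(\<integral>\<^sup>+\<omega>. H \<omega> \<partial>M) < \<infinity>"
      and H: "\<And>\<omega> N. N > 0 \<Longrightarrow> ennreal (?\<Psi> ((\<Sum>i<N. z (r (s i)) \<omega>) / real N / 2)) \<le> H \<omega>"
      using dom[OF s] by blast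
    \<comment> \<open>Here \<open>10 = 2 * 5\<close>: the 2 from using a mean above
      \<open>\<eta> \<omega> / 2\<close> rather than one that attains the supremum, the 5 from the
      convex combination \<open>(p + 4 * q) / 5\<close>.\<close>
    have bound: "AE \<omega> in M. ennreal (?\<Psi> (\<eta> \<omega> / (10 * c))) \<le> ennreal (?\<Psi> (\<xi> \<omega> / c)) + H \<omega>"
      using E_eq
    proof eventually_elim
      case (elim \<omega>)
      have "0 \<le> E \<omega>" unfolding E_def by (intro SUP_upper2[of 1]) (auto simp: m_def)
      then have "0 \<le> \<eta> \<omega>" using elim by simp
      show ?case
      proof (cases "\<eta> \<omega> = 0")
        case False
        with \<open>0 \<le> \<eta> \<omega>\<close> have "ereal (\<eta> \<omega> / 2) < E \<omega>" using elim by simp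
        then obtain N where N: "N \<ge> 1" "\<eta> \<omega> / 2 < m N \<omega>"
          unfolding E_def by (auto simp: less_SUP_iff)
        define q where "q = (\<Sum>i<N. z (r (s i)) \<omega>) / real N / 2"
        define p where "p = \<bar>\<xi> \<omega>\<bar> / c"
        have "q \<ge> 0" using z_nonneg by (simp add: q_def sum_nonneg)
        have "\<bar>\<Sum>i<N. Y i \<omega>\<bar> \<le> (\<Sum>i<N. \<bar>Y i \<omega>\<bar>)" by (rule sum_abs)
        also have "\<dots> \<le> (\<Sum>i<N. \<bar>\<xi> \<omega>\<bar> + 2 * c * z (r (s i)) \<omega>)"
          using c by (intro sum_mono) (simp add: z_def Y_def)
        \<comment> \<open>The 4 combines the factor 2 in front of \<open>c * z\<close> with the
          halving in \<open>q\<close>.\<close>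
        also have "\<dots> = real N * (\<bar>\<xi> \<omega>\<bar> + 4 * c * q)"
          using N by (simp add: q_def sum.distrib sum_distrib_left[symmetric] field_simps)
        finally have "m N \<omega> \<le> \<bar>\<xi> \<omega>\<bar> + 4 * c * q"
          using N by (simp add: m_def cesaro_mean_def abs_mult field_simps)
        then have "\<eta> \<omega> / (10 * c) \<le> (p + 4 * q) / 5"
          using N c by (simp add: p_def field_simps)
        also have "\<dots> \<le> max p q" by (cases "p \<le> q") (simp_all add: max_def field_simps)
        finally have "?\<Psi> (\<eta> \<omega> / (10 * c)) \<le> ?\<Psi> (max p q)"
          using \<open>q \<ge> 0\<close> \<open>0 \<le> \<eta> \<omega>\<close> c by (intro mono) simp
        also have "\<dots> \<le> ?\<Psi> p + ?\<Psi> q" by (simp add: max_def)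
        also have "?\<Psi> p = ?\<Psi> (\<xi> \<omega> / c)"
          using c abs_arg[of "\<xi> \<omega> / c"] by (simp add: p_def)
        finally have "ennreal (?\<Psi> (\<eta> \<omega> / (10 * c))) \<le> ennreal (?\<Psi> (\<xi> \<omega> / c)) + ennreal (?\<Psi> q)"
          by (subst ennreal_plus[symmetric]) (auto intro: ennreal_leI simp del: ennreal_plus)
        also have "\<dots> \<le> ennreal (?\<Psi> (\<xi> \<omega> / c)) + H \<omega>"
          using H[of N \<omega>] N unfolding q_def by (intro add_mono) auto
        finally show ?thesis .
      qed (simp add: zero)
    qed
    have "(\<integral>\<^sup>+\<omega>. ennreal (?\<Psi> (\<eta> \<omega> / (10 * c))) \<partial>M) \<le> (\<integral>\<^sup>+\<omega>. ennreal (?\<Psi> (\<xi> \<omega> / c)) + H \<omega> \<partial>M)"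
      by (rule nn_integral_mono_AE[OF bound])
    also have "\<dots> = (\<integral>\<^sup>+\<omega>. ennreal (?\<Psi> (\<xi> \<omega> / c)) \<partial>M) + (\<integral>\<^sup>+\<omega>. H \<omega> \<partial>M)"
      by (rule nn_integral_add) measurable
    also have "\<dots> < \<infinity>" using \<xi>_mod H_fin by (auto intro: le_less_trans)
    finally have "\<eta> \<in> orlicz_space M ?\<Psi>"
      using c by (intro orlicz_space_if_finite_modular[of \<eta> M "10 * c"]) auto
    with E_eq show "ereal_mem_orlicz M ?\<Psi>
        (\<lambda>\<omega>. SUP N\<in>{1..}. ereal \<bar>cesaro_mean (\<lambda>i. X (u (r (s i)))) N \<omega>\<bar>)"
      unfolding ereal_mem_orlicz_def E_def m_def Y_def by blast
  qed
  \<comment> \<open>\<open>u\<close> provides almost sure convergence and \<open>r\<close> sparsity;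
    both were fixed before \<open>s\<close>.\<close>
  then show ?thesis
    using strict_mono_o[OF u r] by (intro exI[of _ "u \<circ> r"]) (simp add: o_def)
qed

end
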